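(* Let $$\mathcal{K}=\{ab\in\mathcal{P}^2\;|\;|ab|=1\}\quad\text{and}\quad r=\emptyset$$ (the empty word), and let $\mathcal{U}=\{[a,b]\times\{c\}\;|\;a,b,c\in\mathbb{R},\ a<b\}$ be the system of proper horizontal segments. There exists a general $\mathrm{EC}(\mathcal{U})$ $T$ constructing $\mathcal{K}$ (a unit length) from $r$ (from nothing).
   Context: For a set (alphabet) $A$, $A^*$ is the set of finite words over $A$, including the empty word $\emptyset$. A rooted tree $T=(r,V,E)$ consists of a vertex set $V$, a root $r\in V$ and edges $E\subset V\times V$ such that for every $u\in V$ there is a unique walk from $r$ to $u$; if $(u,v)\in E$ then $v$ is a child of $u$; a leaf is a vertex with no child; a branch is a maximal (finite or infinite) walk; it starts at $r$ and either ends in a leaf or is infinite. $\mathcal{P}=\mathbb{R}^2$ is the set of points, $\mathcal{L}$ the set of lines in $\mathbb{R}^2$, $\mathcal{C}$ the set of circles of positive radius in $\mathbb{R}^2$; elements of $\mathcal{L}\cup\mathcal{C}$ are called curves. $|ab|$ is the Euclidean distance of points $a,b$. For points $a\ne b$, $l(a,b)$ is the line through $a,b$. For points $a$ and $b\neq c$, $k(a,b,c)$ is the circle with center $a$ and radius $|bc|$; moreover $k(a,b,b)=a\in\mathcal{P}$. A pair of points $ab\in\mathcal{P}^2$ is regarded as a two-letter word. Let $\mathcal{S}$ be a set of nonempty subsets of $\mathbb{R}^2$ with $(\mathcal{P}\cup\mathcal{L}\cup\mathcal{C})\cap\mathcal{S}=\emptyset$. An $\mathrm{EC}(\mathcal{S})$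 (Euclidean construction with $\mathcal{S}$-arbitrary points) is a rooted tree $T=(r,V,E)$ with $V\subset(\mathcal{P}\cup\mathcal{L}\cup\mathcal{C}\cup\mathcal{S})^*$ and $r\in(\mathcal{P}\cup\mathcal{L}\cup\mathcal{C})^*$, in which the children of each vertex $u=a_1a_2\dots a_m$, $m\ge0$, are determined by exactly one of the following rules (the rule and the choices in it may vary from vertex to vertex); in rules 1–5, $u$ is deterministic, i.e. $m=0$ or $a_m\notin\mathcal{S}$. 1. $u$ is a leaf. 2. $u$ has exactly one child $a_1\dots a_ma_{m+1}$, where $a_{m+1}=l(a_i,a_j)$ for some $1\le i<j\le m$ with $a_i,a_j\in\mathcal{P}$, $a_i\ne a_j$. 3. $u$ has exactly one child $a_1\dots a_ma_{m+1}$, where $a_{m+1}=k(a_i,a_j,a_k)$ for some $1\le i,j,k\le m$ with $a_i,a_j,a_k\in\mathcal{P}$. 4. $u$ has exactly one child $a_1\dots a_ma_{m+1}$, where $a_{m+1}\in\mathcal{P}$ is an intersection point of two curves $a_i\ne a_j$, $1\le i<j\le m$. 5. $u$ has exactly one child $a_1\dots a_ma_{m+1}$, where $a_{m+1}\in\mathcal{S}$. 6. $m\ge1$, $a_m\in\mathcal{S}$ ($u$ is non-deterministic) and the children of $u$ are exactly the words $a_1\dots a_ma_{m+1}$, one for each point $a_{m+1}\in a_m$. A general construction is one in which all these rules are allowed (both compass and straightedge). $T$ is terminating if all its branches are finite. For $\mathcal{K}\subset(\mathcal{P}\cup\mathcal{L}\cup\mathcal{C})^*$, $T=(r,V,E)$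 constructs $\mathcal{K}$ from $r$ if $T$ is a terminating $\mathrm{EC}(\mathcal{S})$ with root $r$ such that every leaf $a_1\dots a_m$ of $T$ has a final segment $a_ja_{j+1}\dots a_m\in\mathcal{K}$. *)

theory Defs
  imports "HOL-Analysis.Analysis" "HOL-Library.Sublist"
begin

section \<open>Rooted trees\<close>

record 'v rtree =
  troot :: 'v
  tverts :: "'v set"
  tedges :: "('v \<times> 'v) set"

definition children :: "'v rtree \<Rightarrow> 'v \<Rightarrow> 'v set" where
  "children T u = {v. (u, v) \<in> tedges T}"

definition leaf :: "'v rtree \<Rightarrow> 'v \<Rightarrow> bool" where
  "leaf T u \<longleftrightarrow> u \<in> tverts T \<and> children T u = {}"

text \<open>A finite walk is the nonempty list of its vertices; \<open>[u]\<close> is the trivial walk from \<open>u\<close> to \<open>u\<close>.\<close>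

definition walk_betw :: "'v rtree \<Rightarrow> 'v \<Rightarrow> 'v list \<Rightarrow> 'v \<Rightarrow> bool" where
  "walk_betw T u ws v \<longleftrightarrow>
     ws \<noteq> [] \<and> set ws \<subseteq> tverts T \<and> hd ws = u \<and> last ws = v \<and>
     successively (\<lambda>x y. (x, y) \<in> tedges T) ws"

definition rooted_tree :: "'v rtree \<Rightarrow> bool" where
  "rooted_tree T \<longleftrightarrow>
     troot T \<in> tverts T \<and> tedges T \<subseteq> tverts T \<times> tverts T \<and>
     (\<forall>u\<in>tverts T. \<exists>!ws. walk_betw T (troot T) ws u)"

text \<open>In a rooted tree every maximal walk starts at the root, so the infinite branches
  are exactly the infinite walks from the root.\<close>

definition infinite_branch :: "'v rtree \<Rightarrow> (nat \<Rightarrow> 'v) \<Rightarrow> bool" where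
  "infinite_branch T f \<longleftrightarrow> f 0 = troot T \<and> (\<forall>n. (f n, f (Suc n)) \<in> tedges T)"

definition terminating :: "'v rtree \<Rightarrow> bool" where
  "terminating T \<longleftrightarrow> (\<nexists>f. infinite_branch T f)"

section \<open>Points, curves and words\<close>

type_synonym point = "real \<times> real"

definition lines :: "point set set" where
  "lines = {affine hull {a, b} | a b. a \<noteq> b}"

definition circles :: "point set set" where
  "circles = {sphere a \<rho> | a \<rho>. \<rho> > 0}"

text \<open>A letter is a point or a subset of the plane (a line, a circle or a member of \<open>\<S>\<close>).
  The two constructors keep a point \<open>a\<close> apart from the set \<open>{a}\<close>.\<close>

datatype letter = Pt point | Fig "point set"

definition alphabet :: "point set set \<Rightarrow> letter set" where
  "alphabet \<S> = range Pt \<union> Fig ` (lines \<union> circles \<union> \<S>)"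

definition line_through :: "point \<Rightarrow> point \<Rightarrow> letter" where
  "line_through a b = Fig (affine hull {a, b})"

text \<open>The degenerate circle \<open>k(a,b,b)\<close> is the point \<open>a\<close>.\<close>

definition compass :: "point \<Rightarrow> point \<Rightarrow> point \<Rightarrow> letter" where
  "compass a b c = (if b = c then Pt a else Fig (sphere a (dist b c)))"

section \<open>Euclidean constructions with arbitrary points\<close>

definition deterministic :: "point set set \<Rightarrow> letter list \<Rightarrow> bool" where
  "deterministic \<S> u \<longleftrightarrow> u = [] \<or> last u \<notin> Fig ` \<S>"

text \<open>\<open>ec_rule \<S> u C\<close>: one of the rules allows \<open>C\<close> to be the set of children of \<open>u\<close>.
  Positions in words are counted from 0.  The rules may overlap in their outcome (a point
  obtained as \<open>k(a,b,b)\<close> may also be an intersection point); this is harmless, because only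
  the set of children, and not the rule producing it, is part of a construction.\<close>

inductive ec_rule :: "point set set \<Rightarrow> letter list \<Rightarrow> letter list set \<Rightarrow> bool"
  for \<S> :: "point set set" and u :: "letter list" where
  stop: "deterministic \<S> u \<Longrightarrow> ec_rule \<S> u {}"
| line: "deterministic \<S> u \<Longrightarrow> i < j \<Longrightarrow> j < length u \<Longrightarrow>
    u ! i = Pt a \<Longrightarrow> u ! j = Pt b \<Longrightarrow> a \<noteq> b \<Longrightarrow>
    ec_rule \<S> u {u @ [line_through a b]}"
| circle: "deterministic \<S> u \<Longrightarrow> i < length u \<Longrightarrow> j < length u \<Longrightarrow> k < length u \<Longrightarrow>
    u ! i = Pt a \<Longrightarrow> u ! j = Pt b \<Longrightarrow> u ! k = Pt c \<Longrightarrow>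
    ec_rule \<S> u {u @ [compass a b c]}"
| intersection: "deterministic \<S> u \<Longrightarrow> i < j \<Longrightarrow> j < length u \<Longrightarrow>
    u ! i = Fig X \<Longrightarrow> u ! j = Fig Y \<Longrightarrow> X \<in> lines \<union> circles \<Longrightarrow> Y \<in> lines \<union> circles \<Longrightarrow>
    X \<noteq> Y \<Longrightarrow> p \<in> X \<inter> Y \<Longrightarrow>
    ec_rule \<S> u {u @ [Pt p]}"
| choose_set: "deterministic \<S> u \<Longrightarrow> X \<in> \<S> \<Longrightarrow> ec_rule \<S> u {u @ [Fig X]}"
| arbitrary_point: "u \<noteq> [] \<Longrightarrow> last u = Fig X \<Longrightarrow> X \<in> \<S> \<Longrightarrow>
    ec_rule \<S> u {u @ [Pt p] | p. p \<in> X}"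

text \<open>The first two conjuncts are the standing assumptions on \<open>\<S>\<close>; disjointness of \<open>\<S>\<close>
  from the set of points is enforced by the type of letters.\<close>

definition general_EC :: "point set set \<Rightarrow> letter list rtree \<Rightarrow> bool" where
  "general_EC \<S> T \<longleftrightarrow>
     {} \<notin> \<S> \<and> (lines \<union> circles) \<inter> \<S> = {} \<and>
     rooted_tree T \<and>
     tverts T \<subseteq> lists (alphabet \<S>) \<and> troot T \<in> lists (alphabet {}) \<and>
     (\<forall>u\<in>tverts T. ec_rule \<S> u (children T u))"

definition constructs ::
  "point set set \<Rightarrow> letter list rtree \<Rightarrow> letter list set \<Rightarrow> letter list \<Rightarrow> bool" where
  "constructs \<S> T \<K> r \<longleftrightarrow>
     \<K> \<subseteq> lists (alphabet {}) \<and>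
     general_EC \<S> T \<and> terminating T \<and> troot T = r \<and>
     (\<forall>u. leaf T u \<longrightarrow> (\<exists>w\<in>\<K>. suffix w u))"

end

theory Submission
  imports Defs
begin

text \<open>Two points on each of the horizontal lines \<open>y = 0\<close> and \<open>y = 1\<close> can be picked from
  disjoint segments, and they determine these lines exactly, although the points themselves
  are arbitrary. The perpendicular bisector of the two points on the first line then cuts
  the two lines in points at distance one.\<close>

section \<open>Trees of words\<close>

text \<open>Every edge appends one letter, so the vertex before \<open>u\<close> on a walk can only
  be \<open>u\<close> without its last letter. A walk from the empty word to \<open>u\<close> must
  therefore be \<open>prefixes u\<close>, and reachability makes this list a walk.\<close>

lemma rooted_tree_words:
  assumes root: "troot T = []"
    and verts: "tverts T = (tedges T)\<^sup>* `` {[]}"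
    and sub: "tedges T \<subseteq> tverts T \<times> tverts T"
    and ext: "\<And>u v. (u, v) \<in> tedges T \<Longrightarrow> \<exists>x. v = u @ [x]"
  shows "rooted_tree T"
proof -
  have unique: "ws = prefixes u" if "walk_betw T [] ws u" for ws u
    using that
  proof (induction ws arbitrary: u rule: rev_induct)
    case Nil
    then show ?case by (simp add: walk_betw_def)
  next
    case (snoc y ws)
    show ?case
    proof (cases "ws = []")
      case True
      then show ?thesis using snoc.prems by (auto simp: walk_betw_def)
    next
      case False
      have y: "y = u" using snoc.prems by (simp add: walk_betw_def)
      have walk: "walk_betw T [] ws (last ws)" and "(last ws, u) \<in> tedges T"
        using snoc.prems False by (auto simp: walk_betw_def successively_append_iff)
      then obtain x where "u = last ws @ [x]" using ext by blast
      then show ?thesis using snoc.IH[OF walk] y by simp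
    qed
  qed
  have exists: "walk_betw T [] (prefixes u) u" if "([], u) \<in> (tedges T)\<^sup>*" for u
    using that
  proof (induction rule: rtrancl_induct)
    case base
    then show ?case by (simp add: walk_betw_def verts)
  next
    case (step u v)
    obtain x where "v = u @ [x]" using ext step.hyps(2) by blast
    moreover have "v \<in> tverts T" using sub step.hyps(2) by blast
    ultimately show ?case using step.IH step.hyps(2)
      by (auto simp: walk_betw_def successively_append_iff)
  qed
  show ?thesis
    unfolding rooted_tree_def
  proof (intro conjI ballI)
    fix u
    assume "u \<in> tverts T"
    then show "\<exists>!ws. walk_betw T (troot T) ws u"
      using unique exists unfolding verts root by (intro ex1I[of _ "prefixes u"]) auto
  qed (use sub root verts in auto)
qed

section \<open>Constructions as games\<close>

text \<open>The bound \<open>n\<close> on the number of remaining steps serves as a rank: choosing at every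
  word a rule that lowers the least bound makes the resulting tree terminating.\<close>

inductive constructible :: "point set set \<Rightarrow> letter list set \<Rightarrow> nat \<Rightarrow> letter list \<Rightarrow> bool"
  for \<S> :: "point set set" and \<K> :: "letter list set" where
  stop: "deterministic \<S> u \<Longrightarrow> w \<in> \<K> \<Longrightarrow> suffix w u \<Longrightarrow> constructible \<S> \<K> n u"
| step: "ec_rule \<S> u C \<Longrightarrow> C \<noteq> {} \<Longrightarrow> (\<And>v. v \<in> C \<Longrightarrow> constructible \<S> \<K> n v) \<Longrightarrow>
    constructible \<S> \<K> (Suc n) u"

lemma ec_rule_child:
  assumes "ec_rule \<S> u C" "v \<in> C"
  shows "\<exists>x\<in>alphabet \<S>. v = u @ [x]"
proof -
  have line: "line_through a b \<in> alphabet \<S>" if "a \<noteq> b" for a b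
    using that unfolding line_through_def alphabet_def lines_def by blast
  have circle: "compass a b c \<in> alphabet \<S>" for a b c
  proof -
    have "sphere a (dist b c) \<in> circles" if "b \<noteq> c"
      using that zero_less_dist_iff unfolding circles_def by blast
    then show ?thesis by (auto simp: compass_def alphabet_def)
  qed
  have point: "Pt p \<in> alphabet \<S>" for p by (simp add: alphabet_def)
  have set: "Fig X \<in> alphabet \<S>" if "X \<in> \<S>" for X
    using that by (simp add: alphabet_def)
  from assms(1) show ?thesis
    by cases (use assms(2) line circle point set in auto)
qed

text \<open>Hilbert choice fixes one admissible set of children at each constructible word; the tree
  grown from the empty word by these choices is the construction sought.\<close>

lemma constructible_imp_constructs:
  assumes "constructible \<S> \<K> N []"
    and nonempty: "{} \<notin> \<S>" and disjoint: "(lines \<union> circles) \<inter> \<S> = {}"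
    and \<K>: "\<K> \<subseteq> lists (alphabet {})"
  shows "\<exists>T. constructs \<S> T \<K> []"
proof -
  \<comment> \<open>A word may be constructible with many bounds; the least one is taken. Its value
    matters only at constructible words.\<close>
  define rank where "rank u = (LEAST n. constructible \<S> \<K> n u)" for u
  let ?good = "\<lambda>u C. ec_rule \<S> u C \<and> (C = {} \<longrightarrow> (\<exists>w\<in>\<K>. suffix w u)) \<and>
    (\<forall>v\<in>C. (\<exists>n. constructible \<S> \<K> n v) \<and> rank v < rank u)"
  have good_ex: "\<exists>C. ?good u C" if ex: "\<exists>n. constructible \<S> \<K> n u" for u
  proof -
    have "constructible \<S> \<K> (rank u) u"
      unfolding rank_def using ex by (rule LeastI_ex)
    then show ?thesis
    proof cases
      case stop
      then show ?thesis using ec_rule.stop by blast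
    next
      case (step C n)
      \<comment> \<open>Here \<open>rank u\<close> is \<open>Suc n\<close>, and the same derivation
        gives each child the bound \<open>n\<close>, so the rank drops strictly.\<close>
      have "rank v \<le> n" if "v \<in> C" for v
        unfolding rank_def using step(4)[OF that] by (rule Least_le)
      then show ?thesis using step by (intro exI[of _ C]) force
    qed
  qed
  define ch where "ch u = (SOME C. ?good u C)" for u
  have ch: "?good u (ch u)" if "\<exists>n. constructible \<S> \<K> n u" for u
    unfolding ch_def using good_ex[OF that] by (rule someI_ex)
  \<comment> \<open>The relation also relates words at which \<open>ch\<close> is meaningless; the
    induction below shows that these are never reached from \<open>[]\<close>.\<close>
  define V where "V = {(u, v). v \<in> ch u}\<^sup>* `` {[]}"
  define T where "T = \<lparr>troot = [], tverts = V, tedges = {(u, v). u \<in> V \<and> v \<in> ch u}\<rparr>"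
  have V: "(\<exists>n. constructible \<S> \<K> n u) \<and> u \<in> lists (alphabet \<S>) \<and> ([], u) \<in> (tedges T)\<^sup>*"
    if "u \<in> V" for u
  proof -
    have "([], u) \<in> {(u, v). v \<in> ch u}\<^sup>*" using that by (simp add: V_def)
    then show ?thesis
    proof (induction rule: rtrancl_induct)
      case base
      then show ?case using assms(1) by auto
    next
      case (step u v)
      have u: "u \<in> V" and v: "v \<in> ch u" using step.hyps by (auto simp: V_def)
      have good: "?good u (ch u)" using ch step.IH by blast
      then obtain x where "x \<in> alphabet \<S>" "v = u @ [x]"
        using ec_rule_child[of \<S> u "ch u" v] v by blast
      then have "v \<in> lists (alphabet \<S>)" using step.IH by simp
      moreover have "(u, v) \<in> tedges T" using u v by (simp add: T_def)
      ultimately show ?case using good v step.IH rtrancl_into_rtrancl[of "[]" u] by blast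
    qed
  qed
  have good: "?good u (ch u)" if "u \<in> V" for u using ch V that by blast
  have closed: "v \<in> V" if "u \<in> V" "v \<in> ch u" for u v
    using that unfolding V_def by (auto intro: rtrancl_into_rtrancl)
  have root: "[] \<in> V" by (simp add: V_def)
  have children: "children T u = ch u" if "u \<in> V" for u
    using that by (simp add: children_def T_def)
  have edges: "u \<in> V \<and> v \<in> ch u \<and> v \<in> V" if "(u, v) \<in> tedges T" for u v
    using that by (auto simp: T_def intro: closed)
  have "rooted_tree T"
  proof (rule rooted_tree_words)
    have "u \<in> V" if "([], u) \<in> (tedges T)\<^sup>*" for u
      using that root edges by cases blast+
    moreover have "tverts T = V" by (simp add: T_def)
    ultimately show "tverts T = (tedges T)\<^sup>* `` {[]}" using V by blast
    show "tedges T \<subseteq> tverts T \<times> tverts T"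
      using edges \<open>tverts T = V\<close> by auto
    show "\<exists>x. v = u @ [x]" if "(u, v) \<in> tedges T" for u v
      using edges[OF that] good[of u] ec_rule_child[of \<S> u "ch u" v] by blast
  qed (simp add: T_def)
  moreover have "terminating T"
    unfolding terminating_def
  proof
    assume "\<exists>f. infinite_branch T f"
    then obtain f where f: "(f n, f (Suc n)) \<in> tedges T" for n
      by (auto simp: infinite_branch_def)
    \<comment> \<open>Along an infinite branch the ranks would form an infinite descending sequence
      of naturals.\<close>
    have "rank (f (Suc n)) < rank (f n)" for n
      using edges[OF f] good by blast
    then have "\<exists>f. \<forall>n. (f (Suc n), f n) \<in> Wellfounded.measure rank" by (intro exI[of _ f]) simp
    then show False using wf_measure[of rank] unfolding wf_iff_no_infinite_down_chain by blast
  qed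
  moreover have "\<exists>w\<in>\<K>. suffix w u" if "leaf T u" for u
  proof -
    have "u \<in> V" "ch u = {}" using that children by (auto simp: leaf_def T_def)
    then show ?thesis using good by blast
  qed
  moreover have "general_EC \<S> T"
    unfolding general_EC_def
  proof (intro conjI ballI)
    show "tverts T \<subseteq> lists (alphabet \<S>)" using V by (auto simp: T_def)
    show "ec_rule \<S> u (children T u)" if "u \<in> tverts T" for u
    proof -
      have "u \<in> V" using that by (simp add: T_def)
      then show ?thesis using good children by simp
    qed
    show "troot T \<in> lists (alphabet {})" by (simp add: T_def)
  qed fact+
  ultimately have "constructs \<S> T \<K> []"
    using \<K> by (auto simp: constructs_def T_def)
  then show ?thesis by blast
qed

lemma constructible_snoc:
  assumes "ec_rule \<S> u {u @ [x]}" "constructible \<S> \<K> n (u @ [x])"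
  shows "constructible \<S> \<K> (Suc n) u"
  using assms by (intro step) auto

text \<open>Naming a set and receiving a point of it cost two steps. Nonemptiness of
  \<open>X\<close> keeps the set of children nonempty, as \<open>step\<close> demands.\<close>

lemma constructible_arbitrary_point:
  assumes "deterministic \<S> u" "X \<in> \<S>" "X \<noteq> {}"
    and "\<And>p. p \<in> X \<Longrightarrow> constructible \<S> \<K> n (u @ [Fig X, Pt p])"
  shows "constructible \<S> \<K> (Suc (Suc n)) u"
proof (rule constructible_snoc)
  show "ec_rule \<S> u {u @ [Fig X]}" using assms by (intro ec_rule.choose_set)
  have "ec_rule \<S> (u @ [Fig X]) {(u @ [Fig X]) @ [Pt p] | p. p \<in> X}"
    using assms by (intro ec_rule.arbitrary_point) auto
  then show "constructible \<S> \<K> (Suc n) (u @ [Fig X])"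
    using assms by (intro step) auto
qed

section \<open>Horizontal and vertical lines\<close>

lemma affine_hull_horizontal:
  fixes a b y :: real
  assumes "a \<noteq> b"
  shows "affine hull {(a, y), (b, y)} = UNIV \<times> {y}"
proof -
  have "(x, y) \<in> affine hull {(a, y), (b, y)}" for x
  proof -
    \<comment> \<open>The solution of \<open>t * a + (1 - t) * b = x\<close>.\<close>
    define t where "t = (x - b) / (a - b)"
    have "t * (a - b) = x - b" using assms by (simp add: t_def)
    then have "(x, y) = t *\<^sub>R (a, y) + (1 - t) *\<^sub>R (b, y)" by (simp add: algebra_simps)
    then show ?thesis unfolding affine_hull_2 by force
  qed
  then show ?thesis
    by (auto simp: affine_hull_2 simp flip: distrib_right)
qed

lemma affine_hull_vertical:
  fixes x h k :: real
  assumes "h \<noteq> k"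
  shows "affine hull {(x, h), (x, k)} = {x} \<times> UNIV"
proof -
  have "(x, y) \<in> affine hull {(x, h), (x, k)}" for y
  proof -
    define t where "t = (y - k) / (h - k)"
    have "t * (h - k) = y - k" using assms by (simp add: t_def)
    then have "(x, y) = t *\<^sub>R (x, h) + (1 - t) *\<^sub>R (x, k)" by (simp add: algebra_simps)
    then show ?thesis unfolding affine_hull_2 by force
  qed
  then show ?thesis
    by (auto simp: affine_hull_2 simp flip: distrib_right)
qed

lemma line_not_bounded:
  assumes "X \<in> lines"
  shows "\<not> bounded X"
proof
  assume "bounded X"
  then obtain B where B: "norm p \<le> B" if "p \<in> X" for p by (auto simp: bounded_iff)
  obtain a b :: point where X: "X = affine hull {a, b}" "a \<noteq> b"
    using assms by (auto simp: lines_def)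
  \<comment> \<open>Makes the displacement \<open>t *\<^sub>R (b - a)\<close> have length
    \<open>\<bar>B\<bar> + norm a + 1\<close>, too long for a point of norm at most \<open>B\<close>
    even after subtracting \<open>a\<close>.\<close>
  define t where "t = (\<bar>B\<bar> + norm a + 1) / norm (b - a)"
  have "(1 - t) *\<^sub>R a + t *\<^sub>R b \<in> X" unfolding X affine_hull_2 by force
  moreover have "(1 - t) *\<^sub>R a + t *\<^sub>R b = a + t *\<^sub>R (b - a)" by (simp add: algebra_simps)
  ultimately have "norm (a + t *\<^sub>R (b - a)) \<le> B" using B by metis
  moreover have "norm (t *\<^sub>R (b - a)) = \<bar>B\<bar> + norm a + 1" using X by (simp add: t_def)
  moreover have "norm (t *\<^sub>R (b - a)) \<le> norm (a + t *\<^sub>R (b - a)) + norm a"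
    by (metis add_diff_cancel_left' norm_triangle_ineq4)
  ultimately show False by linarith
qed

text \<open>Boundedness excludes lines. A circle has a highest and a lowest point, whose ordinates
  differ, whereas a horizontal segment has only one ordinate.\<close>

lemma segment_not_curve:
  fixes a b c :: real
  shows "{a..b} \<times> {c} \<notin> lines \<union> circles"
proof
  assume "{a..b} \<times> {c} \<in> lines \<union> circles"
  moreover have "bounded ({a..b} \<times> {c})" by (intro bounded_Times) auto
  ultimately have "{a..b} \<times> {c} \<in> circles" using line_not_bounded by blast
  then obtain x y \<rho> where S: "{a..b} \<times> {c} = sphere (x, y) \<rho>" "\<rho> > 0"
    by (auto simp: circles_def)
  then have "(x, y + \<rho>) \<in> {a..b} \<times> {c}" "(x, y - \<rho>) \<in> {a..b} \<times> {c}"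
    by (simp_all add: dist_Pair_Pair dist_real_def)
  then show False using S(2) by auto
qed

section \<open>The unit length\<close>

text \<open>The bound 9 counts two horizontal lines, two circles, their two intersection points, the
  bisector and its two feet. The sets \<open>A\<close> to \<open>D\<close> only occupy positions in
  the word.\<close>

lemma constructible_unit_length:
  fixes a b c d :: real and A B C D :: "point set"
  defines "u \<equiv> [Fig A, Pt (a, 0), Fig B, Pt (b, 0), Fig C, Pt (c, 1), Fig D, Pt (d, 1)]"
  assumes disjoint: "(lines \<union> circles) \<inter> \<S> = {}" and ne: "a < b" "c < d"
  shows "constructible \<S> {[Pt p, Pt q] | p q. dist p q = 1} 9 u"
proof -
  \<comment> \<open>The circles about the two points on \<open>y = 0\<close> have radius
    \<open>r\<close>, their distance. They meet at \<open>(m, h)\<close> and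
    \<open>(m, - h)\<close>, the apexes of the equilateral triangles on this base.\<close>
  define r where "r = b - a"
  define m where "m = (a + b) / 2"
  define h where "h = sqrt 3 / 2 * r"
  define S1 where "S1 = sphere (a, 0::real) r"
  define S2 where "S2 = sphere (b, 0::real) r"
  define H0 where "H0 = (UNIV :: real set) \<times> {0::real}"
  define H1 where "H1 = (UNIV :: real set) \<times> {1::real}"
  define M where "M = {m} \<times> (UNIV :: real set)"
  note defs = S1_def S2_def H0_def H1_def M_def
  have "r > 0" "h > 0" using ne by (auto simp: r_def h_def)
  have lines: "line_through (a, 0) (b, 0) = Fig H0" "line_through (c, 1) (d, 1) = Fig H1"
      "line_through (m, h) (m, - h) = Fig M"
    using ne \<open>h > 0\<close>
    by (simp_all add: line_through_def defs affine_hull_horizontal affine_hull_vertical)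
  have compass: "compass (a, 0) (a, 0) (b, 0) = Fig S1" "compass (b, 0) (a, 0) (b, 0) = Fig S2"
    using ne by (simp_all add: compass_def defs r_def dist_Pair_Pair dist_real_def)
  have "H0 \<in> lines" "H1 \<in> lines" "M \<in> lines"
    using lines ne \<open>h > 0\<close> by (force simp: line_through_def lines_def)+
  moreover have "S1 \<in> circles" "S2 \<in> circles"
    using \<open>r > 0\<close> by (auto simp: circles_def defs)
  ultimately have curves: "H0 \<in> lines \<union> circles" "H1 \<in> lines \<union> circles"
      "M \<in> lines \<union> circles" "S1 \<in> lines \<union> circles" "S2 \<in> lines \<union> circles"
    by blast+
  \<comment> \<open>A word ending in one of these curves is thus deterministic, so another curve or
    point may follow.\<close>
  then have figs: "H0 \<notin> \<S>" "H1 \<notin> \<S>" "M \<notin> \<S>" "S1 \<notin> \<S>" "S2 \<notin> \<S>"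
    using disjoint by blast+
  \<comment> \<open>The centre of \<open>S2\<close> lies on \<open>S1\<close> but not on
    \<open>S2\<close>, which tells the circles apart.\<close>
  have "(b, 0) \<in> S1" "(b, 0) \<notin> S2"
    using \<open>r > 0\<close> by (simp_all add: defs dist_Pair_Pair dist_real_def r_def)
  then have "S1 \<noteq> S2" by blast
  have "(m - a)\<^sup>2 + h\<^sup>2 = r\<^sup>2" "(m - b)\<^sup>2 + h\<^sup>2 = r\<^sup>2"
    by (simp_all add: m_def h_def r_def power_mult_distrib power_divide
        power2_eq_square field_simps)
  then have apex: "(m, h) \<in> S1 \<inter> S2" "(m, - h) \<in> S1 \<inter> S2"
    using \<open>r > 0\<close>
    by (simp_all add: defs dist_Pair_Pair dist_real_def power2_commute[of m])
  have feet: "(m, 0) \<in> H0 \<inter> M" "(m, 1) \<in> H1 \<inter> M" by (simp_all add: defs)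
  have "(m + 1, 0) \<in> H0 - M" "(m + 1, 1) \<in> H1 - M" by (simp_all add: defs)
  then have neq: "H0 \<noteq> M" "H1 \<noteq> M" by blast+
  let ?w1 = "u @ [Fig H0]"
  let ?w2 = "?w1 @ [Fig H1]"
  let ?w3 = "?w2 @ [Fig S1]"
  let ?w4 = "?w3 @ [Fig S2]"
  let ?w5 = "?w4 @ [Pt (m, h)]"
  let ?w6 = "?w5 @ [Pt (m, - h)]"
  let ?w7 = "?w6 @ [Fig M]"
  let ?w8 = "?w7 @ [Pt (m, 0)]"
  let ?w9 = "?w8 @ [Pt (m, 1)]"
  have det: "deterministic \<S> u" "deterministic \<S> ?w1" "deterministic \<S> ?w2"
      "deterministic \<S> ?w3" "deterministic \<S> ?w4" "deterministic \<S> ?w5"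
      "deterministic \<S> ?w6" "deterministic \<S> ?w7" "deterministic \<S> ?w8"
      "deterministic \<S> ?w9"
    using figs by (auto simp: deterministic_def u_def)
  \<comment> \<open>In \<open>u\<close> the points are at the odd positions: 1 and 3 on
    \<open>y = 0\<close>, 5 and 7 on \<open>y = 1\<close>. Then \<open>H0\<close>,
    \<open>H1\<close>, \<open>S1\<close>, \<open>S2\<close> take 8 to 11, the apexes 12 and 13, and
    \<open>M\<close> takes 14.\<close>
  have rules: "ec_rule \<S> u {?w1}" "ec_rule \<S> ?w1 {?w2}" "ec_rule \<S> ?w2 {?w3}"
      "ec_rule \<S> ?w3 {?w4}" "ec_rule \<S> ?w6 {?w7}"
    using line[OF det(1), of 1 3 "(a, 0)" "(b, 0)"] line[OF det(2), of 5 7 "(c, 1)" "(d, 1)"]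
      circle[OF det(3), of 1 1 3 "(a, 0)" "(a, 0)" "(b, 0)"]
      circle[OF det(4), of 3 1 3 "(b, 0)" "(a, 0)" "(b, 0)"]
      line[OF det(7), of 12 13 "(m, h)" "(m, - h)"]
      ne \<open>h > 0\<close>
    by (simp_all add: u_def lines compass)
  have inter: "ec_rule \<S> ?w4 {?w5}" "ec_rule \<S> ?w5 {?w6}"
      "ec_rule \<S> ?w7 {?w8}" "ec_rule \<S> ?w8 {?w9}"
    by (rule intersection[of _ _ 10 11, OF det(5) _ _ _ _ curves(4,5) \<open>S1 \<noteq> S2\<close> apex(1)]
        intersection[of _ _ 10 11, OF det(6) _ _ _ _ curves(4,5) \<open>S1 \<noteq> S2\<close> apex(2)]
        intersection[of _ _ 8 14, OF det(8) _ _ _ _ curves(1,3) neq(1) feet(1)]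
        intersection[of _ _ 9 14, OF det(9) _ _ _ _ curves(2,3) neq(2) feet(2)];
        simp add: u_def)+
  have final: "constructible \<S> {[Pt p, Pt q] | p q. dist p q = 1} 0 ?w9"
    by (rule stop[OF det(10), where w = "[Pt (m, 0), Pt (m, 1)]"])
       (auto simp: suffix_def dist_Pair_Pair)
  show ?thesis
    \<comment> \<open>Turns the numeral 9 into nested \<open>Suc\<close>, one for each use of
      \<open>constructible_snoc\<close>.\<close>
    unfolding eval_nat_numeral BitM.simps
    by (rule constructible_snoc[OF rules(1)], rule constructible_snoc[OF rules(2)],
        rule constructible_snoc[OF rules(3)], rule constructible_snoc[OF rules(4)],
        rule constructible_snoc[OF inter(1)], rule constructible_snoc[OF inter(2)],
        rule constructible_snoc[OF rules(5)], rule constructible_snoc[OF inter(3)],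
        rule constructible_snoc[OF inter(4)], rule final)
qed

theorem proposition2p8:
  fixes \<K> :: "letter list set" and r :: "letter list" and \<U> :: "(real \<times> real) set set"
  assumes "\<K> = {[Pt a, Pt b] | a b. dist a b = 1}"
    and "r = []"
    and "\<U> = {{a..b} \<times> {c} | a b c. a < b}"
  shows "\<exists>T. general_EC \<U> T \<and> constructs \<U> T \<K> r"
proof -
  have disjoint: "(lines \<union> circles) \<inter> \<U> = {}"
    using segment_not_curve by (auto simp: assms(3))
  have \<U>: "{a..a + 1} \<times> {c} \<in> \<U>" "{a..a + 1} \<times> {c} \<noteq> {}" for a c :: real
    by (force simp: assms(3))+
  have point: "constructible \<U> \<K> (Suc (Suc n)) u"
    if "deterministic \<U> u"
      "\<And>x. x \<in> {a..a + 1} \<Longrightarrow> constructible \<U> \<K> n (u @ [Fig ({a..a + 1} \<times> {c}), Pt (x, c)])"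
    for u n and a c :: real
    using that by (intro constructible_arbitrary_point[OF _ \<U>[of a c]]) auto
  \<comment> \<open>Four arbitrary points cost eight steps before the remaining nine. On each line
    the abscissas come from \<open>[0, 1]\<close> and \<open>[2, 3]\<close>, so they are in
    increasing order whichever points are picked.\<close>
  have "constructible \<U> \<K> (Suc (Suc (Suc (Suc (Suc (Suc (Suc (Suc 9)))))))) []"
  proof (rule point[where a = 0 and c = 0], simp add: deterministic_def,
      rule point[where a = 2 and c = 0], force simp: deterministic_def,
      rule point[where a = 0 and c = 1], force simp: deterministic_def,
      rule point[where a = 2 and c = 1], force simp: deterministic_def)
    fix a b c d :: real
    assume "a \<in> {0..0 + 1}" "b \<in> {2..2 + 1}" "c \<in> {0..0 + 1}" "d \<in> {2..2 + 1}"
    then show "constructible \<U> \<K> 9 (((([] @ [Fig ({0..0 + 1} \<times> {0}), Pt (a, 0)]) @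
        [Fig ({2..2 + 1} \<times> {0}), Pt (b, 0)]) @ [Fig ({0..0 + 1} \<times> {1}), Pt (c, 1)]) @
        [Fig ({2..2 + 1} \<times> {1}), Pt (d, 1)])"
      using constructible_unit_length[OF disjoint, of a b c d] by (simp add: assms(1))
  qed
  moreover have "{} \<notin> \<U>" by (force simp: assms(3))
  moreover have "\<K> \<subseteq> lists (alphabet {})" by (auto simp: assms(1) alphabet_def)
  ultimately have "\<exists>T. constructs \<U> T \<K> []"
    using disjoint by (intro constructible_imp_constructs)
  then show ?thesis using assms(2) by (auto simp: constructs_def)
qed

end
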